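(* Let $t\ge3$ and let $H_t$ be a binary Hamming code of length $n=2^t-1$. Then for every integer $r$ with $t/2\le r\le t$, $H_t$ is a $\mathbb{Z}_2\mathbb{Z}_2[u]$-linear code with parameters $(2^r-1,\,2^{t-1}-2^{r-1})$.
   Context: The binary Hamming code $H_t$ of length $2^t-1$ is the binary linear code whose parity-check matrix has as columns all nonzero vectors of $\mathbb{Z}_2^t$. Let $\mathbb{Z}_2[u]=\{0,1,u,1+u\}$ be the ring with $u^2=0$, $\pi:\mathbb{Z}_2[u]\to\mathbb{Z}_2$ with $\pi(0)=\pi(u)=0$, $\pi(1)=\pi(1+u)=1$. $\mathbb{Z}_2^\alpha\times\mathbb{Z}_2[u]^\beta$ is a $\mathbb{Z}_2[u]$-module with componentwise addition and scalar multiplication $\lambda(x_1,\dots,x_\alpha\mid x'_1,\dots,x'_\beta)=(\pi(\lambda)x_1,\dots,\pi(\lambda)x_\alpha\mid\lambda x'_1,\dots,\lambda x'_\beta)$; a $\mathbb{Z}_2\mathbb{Z}_2[u]$-additive code with parameters $(\alpha,\beta)$ is a $\mathbb{Z}_2[u]$-submodule of it. $\psi:\mathbb{Z}_2[u]\to\mathbb{Z}_2^2$ is $\psi(0)=(0,0)$, $\psi(1)=(0,1)$, $\psi(u)=(1,1)$, $\psi(1+u)=(1,0)$, extended coordinatewise, and $\Psi(x\mid x')=(x\mid\psi(x'))$. A binary code $C$ of length $\alpha+2\beta$ is $\mathbb{Z}_2\mathbb{Z}_2[u]$-linear with parameters $(\alpha,\beta)$ if, after a suitable permutation of coordinates, $C=\Psi(\mathcal{C})$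 for a $\mathbb{Z}_2\mathbb{Z}_2[u]$-additive code $\mathcal{C}$ with parameters $(\alpha,\beta)$. *)

theory Defs
  imports
    "HOL-Library.Z2"
    "Jordan_Normal_Form.Matrix_Kernel"
begin

section \<open>Binary Hamming codes\<close>

text \<open>Binary vectors of length \<open>n\<close> are the elements of \<open>carrier_vec n :: bit vec set\<close>. The order of the
  columns of the parity-check matrix is not prescribed, so a Hamming code is determined only up
  to a permutation of the coordinates.\<close>

definition hamming_parity_check :: "nat \<Rightarrow> bit mat \<Rightarrow> bool" where
  "hamming_parity_check t H \<longleftrightarrow>
     H \<in> carrier_mat t (2 ^ t - 1) \<and>
     distinct (cols H) \<and> set (cols H) = carrier_vec t - {0\<^sub>v t}"

definition binary_hamming_code :: "nat \<Rightarrow> bit vec set \<Rightarrow> bool" where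
  "binary_hamming_code t C \<longleftrightarrow> (\<exists>H. hamming_parity_check t H \<and> C = mat_kernel H)"

section \<open>The ring $\mathbb{Z}_2[u]$ with $u^2 = 0$\<close>

text \<open>\<open>Z2u a b\<close> stands for $a + bu$.\<close>

datatype z2u = Z2u (const_coeff: bit) (u_coeff: bit)

instantiation z2u :: comm_ring_1
begin

definition zero_z2u :: z2u where "0 = Z2u 0 0"
definition one_z2u :: z2u where "1 = Z2u 1 0"
definition plus_z2u :: "z2u \<Rightarrow> z2u \<Rightarrow> z2u" where
  "x + y = Z2u (const_coeff x + const_coeff y) (u_coeff x + u_coeff y)"
definition uminus_z2u :: "z2u \<Rightarrow> z2u" where
  "- x = Z2u (- const_coeff x) (- u_coeff x)"
definition minus_z2u :: "z2u \<Rightarrow> z2u \<Rightarrow> z2u" where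
  "x - y = Z2u (const_coeff x - const_coeff y) (u_coeff x - u_coeff y)"
definition times_z2u :: "z2u \<Rightarrow> z2u \<Rightarrow> z2u" where
  "x * y = Z2u (const_coeff x * const_coeff y)
               (const_coeff x * u_coeff y + u_coeff x * const_coeff y)"

instance
proof
  fix a b c :: z2u
  note defs = zero_z2u_def one_z2u_def plus_z2u_def uminus_z2u_def minus_z2u_def times_z2u_def
    z2u.sel z2u.inject
  show "0 + a = a" "1 * a = a"
    by (cases a; simp add: defs)+
  show "a * b * c = a * (b * c)" "a * b = b * a" "(a + b) * c = a * c + b * c"
    "a + b + c = a + (b + c)" "a + b = b + a"
    by (simp_all only: defs) (simp_all only: algebra_simps)
qed (simp_all add: zero_z2u_def one_z2u_def plus_z2u_def uminus_z2u_def minus_z2u_def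
       times_z2u_def)

end

definition z2u_u :: z2u where "z2u_u = Z2u 0 1"

lemma z2u_u_squared: "z2u_u * z2u_u = 0"
  by (simp add: z2u_u_def times_z2u_def zero_z2u_def)

lemma UNIV_z2u: "UNIV = {0, 1, z2u_u, 1 + z2u_u}"
proof -
  have "x \<in> {0, 1, z2u_u, 1 + z2u_u}" for x
  proof (cases x)
    case (Z2u a b)
    then show ?thesis
      by (cases a; cases b) (simp_all add: zero_z2u_def one_z2u_def z2u_u_def plus_z2u_def)
  qed
  then show ?thesis by blast
qed

definition z2u_pi :: "z2u \<Rightarrow> bit" where
  "z2u_pi x = const_coeff x"

lemma z2u_pi_values:
  "z2u_pi 0 = 0" "z2u_pi z2u_u = 0" "z2u_pi 1 = 1" "z2u_pi (1 + z2u_u) = 1"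
  by (simp_all add: z2u_pi_def zero_z2u_def one_z2u_def z2u_u_def plus_z2u_def)

lemma z2u_pi_hom:
  "z2u_pi (x + y) = z2u_pi x + z2u_pi y" "z2u_pi (x * y) = z2u_pi x * z2u_pi y"
  by (simp_all only: z2u_pi_def plus_z2u_def times_z2u_def z2u.sel)

text \<open>The table of values below determines \<open>z2u_psi\<close>; in closed form it reads
  $\psi(a + bu) = (b, a + b)$.\<close>

definition z2u_psi :: "z2u \<Rightarrow> bit \<times> bit" where
  "z2u_psi x = (u_coeff x, const_coeff x + u_coeff x)"

lemma z2u_psi_values:
  "z2u_psi 0 = (0, 0)" "z2u_psi 1 = (0, 1)" "z2u_psi z2u_u = (1, 1)"
  "z2u_psi (1 + z2u_u) = (1, 0)"
  by (simp_all add: z2u_psi_def zero_z2u_def one_z2u_def z2u_u_def plus_z2u_def)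

section \<open>Additive codes\<close>

text \<open>The fields \<open>mult\<close> and \<open>one\<close> of the module record are irrelevant, as in \<open>module_vec\<close>.\<close>

definition Z2_Z2u_space :: "nat \<Rightarrow> nat \<Rightarrow> (z2u, bit vec \<times> z2u vec) module" where
  "Z2_Z2u_space \<alpha> \<beta> =
     \<lparr>carrier = carrier_vec \<alpha> \<times> carrier_vec \<beta>,
      mult = undefined,
      one = undefined,
      zero = (0\<^sub>v \<alpha>, 0\<^sub>v \<beta>),
      add = (\<lambda>(x, x') (y, y'). (x + y, x' + y')),
      smult = (\<lambda>c (x, x'). (z2u_pi c \<cdot>\<^sub>v x, c \<cdot>\<^sub>v x'))\<rparr>"

lemma Z2_Z2u_space_module: "Module.module class_ring (Z2_Z2u_space \<alpha> \<beta>)"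
proof (rule moduleI)
  show "cring (class_ring :: z2u ring)"
    by (rule class_cring.cring_axioms)
  show "abelian_group (Z2_Z2u_space \<alpha> \<beta>)"
  proof (rule abelian_groupI)
    fix x assume "x \<in> carrier (Z2_Z2u_space \<alpha> \<beta>)"
    then show "\<exists>y\<in>carrier (Z2_Z2u_space \<alpha> \<beta>).
        y \<oplus>\<^bsub>Z2_Z2u_space \<alpha> \<beta>\<^esub> x = \<zero>\<^bsub>Z2_Z2u_space \<alpha> \<beta>\<^esub>"
      by (intro bexI[of _ "(- fst x, - snd x)"]) (auto simp: Z2_Z2u_space_def)
  qed (auto simp: Z2_Z2u_space_def intro: comm_add_vec[of _ \<alpha>] comm_add_vec[of _ \<beta>]
         assoc_add_vec[of _ \<alpha>] assoc_add_vec[of _ \<beta>])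
qed (auto simp: Z2_Z2u_space_def z2u_pi_values z2u_pi_hom add_smult_distrib_vec
       smult_add_distrib_vec[of _ \<alpha>] smult_add_distrib_vec[of _ \<beta>] smult_smult_assoc)

definition Z2_Z2u_additive :: "nat \<Rightarrow> nat \<Rightarrow> (bit vec \<times> z2u vec) set \<Rightarrow> bool" where
  "Z2_Z2u_additive \<alpha> \<beta> \<C> \<longleftrightarrow> Module.submodule \<C> class_ring (Z2_Z2u_space \<alpha> \<beta>)"

section \<open>Linear codes\<close>

text \<open>The two coordinates of each $\psi(x'_i)$ are placed next to each other.\<close>

definition z2u_psi_vec :: "z2u vec \<Rightarrow> bit vec" where
  "z2u_psi_vec x' =
     vec (2 * dim_vec x')
       (\<lambda>j. (if even j then fst else snd) (z2u_psi (x' $ (j div 2))))"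

definition Z2_Z2u_Psi :: "bit vec \<times> z2u vec \<Rightarrow> bit vec" where
  "Z2_Z2u_Psi = (\<lambda>(x, x'). x @\<^sub>v z2u_psi_vec x')"

definition permute_vec :: "(nat \<Rightarrow> nat) \<Rightarrow> 'a vec \<Rightarrow> 'a vec" where
  "permute_vec p v = vec (dim_vec v) (\<lambda>i. v $ p i)"

definition Z2_Z2u_linear :: "nat \<Rightarrow> nat \<Rightarrow> bit vec set \<Rightarrow> bool" where
  "Z2_Z2u_linear \<alpha> \<beta> C \<longleftrightarrow>
     C \<subseteq> carrier_vec (\<alpha> + 2 * \<beta>) \<and>
     (\<exists>p \<C>. p permutes {..<\<alpha> + 2 * \<beta>} \<and> Z2_Z2u_additive \<alpha> \<beta> \<C> \<and>
        permute_vec p ` C = Z2_Z2u_Psi ` \<C>)"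

end

theory Submission
  imports Defs "HOL-Combinatorics.Permutations"
begin

text \<open>A subspace of $\mathbb{Z}_2^{\alpha+2\beta}$ is the image under $\Psi$ of an additive code if it
  is invariant under the map $S$ that exchanges the two entries of each of the last $\beta$ pairs,
  because $\Psi(u X) = \Psi(X) + S(\Psi(X))$. An invertible linear map $T$ of $\mathbb{Z}_2^t$
  permutes the columns of the parity-check matrix, and the corresponding permutation of coordinates
  preserves the Hamming code. Take $T = I + N$, where $N$ shifts vectors by $r$ places. Then
  $N^2 = 0$ since $2r \ge t$, so $T$ is an involution, and its fixed space $\ker N$ has dimension
  $r$. Listing the $2^r - 1$ fixed coordinates first and the 2-cycles of the permutation as
  consecutive pairs turns it into $S$.\<close>

section \<open>Arranging an involution into consecutive pairs\<close>

text \<open>The index permutation behind the map \<open>S\<close>. Its pairs match the layout of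
  \<open>Z2_Z2u_Psi\<close>, which puts the two bits of each Gray image next to each other after the
  first \<alpha> places.\<close>

definition pair_swap :: "nat \<Rightarrow> nat \<Rightarrow> nat" where
  "pair_swap \<alpha> j = (if j < \<alpha> then j else if even (j - \<alpha>) then j + 1 else j - 1)"

lemma pair_swap_simps [simp]:
  "j < \<alpha> \<Longrightarrow> pair_swap \<alpha> j = j"
  "pair_swap \<alpha> (\<alpha> + 2 * k) = Suc (\<alpha> + 2 * k)"
  "pair_swap \<alpha> (Suc (\<alpha> + 2 * k)) = \<alpha> + 2 * k"
  by (simp_all add: pair_swap_def Suc_diff_le)

lemma pair_index_cases [consumes 1, case_names single first second]:
  fixes j \<alpha> \<beta> :: nat
  assumes "j < \<alpha> + 2 * \<beta>"
  obtains "j < \<alpha>" | k where "k < \<beta>" "j = \<alpha> + 2 * k" | k where "k < \<beta>" "j = Suc (\<alpha> + 2 * k)"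
proof (cases "j < \<alpha>")
  case False
  then obtain d where d: "j = \<alpha> + d" using le_Suc_ex not_less by blast
  show thesis
  proof (cases "even d")
    case True
    then show thesis using assms d that(2)[of "d div 2"] by auto
  next
    case odd: False
    then show thesis using assms d that(3)[of "d div 2"] by auto
  qed
qed (rule that(1))

lemma pair_swap_less: "j < \<alpha> + 2 * \<beta> \<Longrightarrow> pair_swap \<alpha> j < \<alpha> + 2 * \<beta>"
  by (erule pair_index_cases) auto

text \<open>An involution of a finite set splits it into fixed points and 2-cycles. Removing the
  \<alpha> fixed points leaves 2\<beta> elements, hence exactly \<beta> cycles, which can be listed
  pair by pair.\<close>

lemma involution_arrangement:
  fixes \<sigma> :: "'a::linorder \<Rightarrow> 'a"
  assumes "finite A" "\<And>x. x \<in> A \<Longrightarrow> \<sigma> x \<in> A" "\<And>x. x \<in> A \<Longrightarrow> \<sigma> (\<sigma> x) = x"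
    and fix_card: "card {x \<in> A. \<sigma> x = x} = \<alpha>" and A_card: "card A = \<alpha> + 2 * \<beta>"
  obtains f where "bij_betw f {..<\<alpha> + 2 * \<beta>} A"
    and "\<And>j. j < \<alpha> + 2 * \<beta> \<Longrightarrow> \<sigma> (f j) = f (pair_swap \<alpha> j)"
proof -
  define F where "F = {x \<in> A. \<sigma> x = x}"
  \<comment> \<open>The linear order serves to choose one representative, the smaller element, from
    each 2-cycle. The set is then the disjoint union of \<open>F\<close>, \<open>R\<close> and the
    image of \<open>R\<close>.\<close>
  define R where "R = {x \<in> A. x < \<sigma> x}"
  have fin: "finite F" "finite R" using assms(1) by (auto simp: F_def R_def)
  have inj: "inj_on \<sigma> A" using assms(3) by (metis inj_onI)
  then have card_\<sigma>R: "card (\<sigma> ` R) = card R"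
    by (intro card_image) (auto simp: R_def inj_on_def)
  have A_eq: "A = F \<union> (R \<union> \<sigma> ` R)"
  proof
    show "A \<subseteq> F \<union> (R \<union> \<sigma> ` R)"
    proof
      fix x assume x: "x \<in> A"
      consider "\<sigma> x = x" | "x < \<sigma> x" | "\<sigma> x < x" by fastforce
      then show "x \<in> F \<union> (R \<union> \<sigma> ` R)"
      proof cases
        case 3
        then have "\<sigma> x \<in> R" using x assms(2,3) by (auto simp: R_def)
        then show ?thesis using assms(3)[OF x] by (metis UnCI imageI)
      qed (use x in \<open>auto simp: F_def R_def\<close>)
    qed
  qed (use assms(2) in \<open>auto simp: F_def R_def\<close>)
  have disj: "F \<inter> (R \<union> \<sigma> ` R) = {}" "R \<inter> \<sigma> ` R = {}"
    using assms(3) by (auto simp: F_def R_def)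
  have "card A = card F + 2 * card R"
    using fin by (subst A_eq) (simp add: card_Un_disjoint disj card_\<sigma>R)
  then have "card R = \<beta>" using A_card fix_card by (simp add: F_def)
  then obtain g where g: "bij_betw g {..<\<beta>} R"
    using ex_bij_betw_nat_finite[OF fin(2)] by (auto simp: atLeast0LessThan)
  obtain e where e: "bij_betw e {..<\<alpha>} F"
    using ex_bij_betw_nat_finite[OF fin(1)] fix_card by (auto simp: F_def atLeast0LessThan)
  define f where "f j = (if j < \<alpha> then e j
     else if even (j - \<alpha>) then g ((j - \<alpha>) div 2) else \<sigma> (g ((j - \<alpha>) div 2)))" for j
  have f_pair: "f (\<alpha> + 2 * k) = g k" "f (Suc (\<alpha> + 2 * k)) = \<sigma> (g k)" for k
    by (simp_all add: f_def Suc_diff_le)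
  have gR: "g k \<in> R" if "k < \<beta>" for k using g that by (auto simp: bij_betw_def)
  have eF: "e k \<in> F" if "k < \<alpha>" for k using e that by (auto simp: bij_betw_def)
  have image: "f ` {..<\<alpha> + 2 * \<beta>} = A"
  proof
    show "f ` {..<\<alpha> + 2 * \<beta>} \<subseteq> A"
    proof clarify
      fix j assume "j < \<alpha> + 2 * \<beta>"
      then show "f j \<in> A"
      proof (cases rule: pair_index_cases)
        case single
        then show ?thesis using eF by (auto simp: f_def A_eq)
      qed (use gR in \<open>auto simp: f_pair A_eq\<close>)
    qed
    have "x \<in> f ` {..<\<alpha> + 2 * \<beta>}" if "x \<in> F" for x
    proof -
      obtain j where "j < \<alpha>" "x = e j" using \<open>x \<in> F\<close> e by (auto simp: bij_betw_def)
      then show ?thesis by (intro image_eqI[of _ _ j]) (auto simp: f_def)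
    qed
    moreover have "x \<in> f ` {..<\<alpha> + 2 * \<beta>} \<and> \<sigma> x \<in> f ` {..<\<alpha> + 2 * \<beta>}" if "x \<in> R" for x
    proof -
      obtain k where k: "k < \<beta>" "x = g k" using \<open>x \<in> R\<close> g by (auto simp: bij_betw_def)
      show ?thesis
      proof
        show "x \<in> f ` {..<\<alpha> + 2 * \<beta>}"
          using k by (intro image_eqI[of _ _ "\<alpha> + 2 * k"]) (auto simp: f_pair)
        show "\<sigma> x \<in> f ` {..<\<alpha> + 2 * \<beta>}"
          using k by (intro image_eqI[of _ _ "Suc (\<alpha> + 2 * k)"]) (auto simp: f_pair)
      qed
    qed
    ultimately show "A \<subseteq> f ` {..<\<alpha> + 2 * \<beta>}"
      by (subst A_eq) auto
  qed
  \<comment> \<open>A surjection between finite sets of equal size is injective, so no comparison of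
    the three kinds of index is required.\<close>
  then have "inj_on f {..<\<alpha> + 2 * \<beta>}"
    by (intro eq_card_imp_inj_on) (simp_all add: A_card)
  with image have bij: "bij_betw f {..<\<alpha> + 2 * \<beta>} A" by (simp add: bij_betw_def)
  have "\<sigma> (f j) = f (pair_swap \<alpha> j)" if "j < \<alpha> + 2 * \<beta>" for j
    using that
  proof (cases rule: pair_index_cases)
    case single
    then show ?thesis using eF by (auto simp: f_def F_def)
  next
    case (first k)
    then show ?thesis by (simp add: f_pair)
  next
    case (second k)
    then show ?thesis using gR[of k] assms(3) by (simp add: f_pair R_def)
  qed
  with bij show thesis by (rule that)
qed

section \<open>Gray images of additive codes\<close>

definition swap_vec :: "nat \<Rightarrow> 'a vec \<Rightarrow> 'a vec" where
  "swap_vec \<alpha> v = vec (dim_vec v) (\<lambda>j. v $ pair_swap \<alpha> j)"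

lemma z2u_psi_vec_carrier: "x \<in> carrier_vec \<beta> \<Longrightarrow> z2u_psi_vec x \<in> carrier_vec (2 * \<beta>)"
  by (simp add: z2u_psi_vec_def)

lemma Z2_Z2u_Psi_carrier:
  "x \<in> carrier_vec \<alpha> \<Longrightarrow> x' \<in> carrier_vec \<beta> \<Longrightarrow> Z2_Z2u_Psi (x, x') \<in> carrier_vec (\<alpha> + 2 * \<beta>)"
  by (simp add: Z2_Z2u_Psi_def z2u_psi_vec_carrier)

lemma Z2_Z2u_Psi_index:
  assumes "x \<in> carrier_vec \<alpha>" "x' \<in> carrier_vec \<beta>" "j < \<alpha> + 2 * \<beta>"
  shows "Z2_Z2u_Psi (x, x') $ j = (if j < \<alpha> then x $ j
    else (if even (j - \<alpha>) then fst else snd) (z2u_psi (x' $ ((j - \<alpha>) div 2))))"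
  using assms by (auto simp: Z2_Z2u_Psi_def z2u_psi_vec_def)

lemma Z2_Z2u_Psi_index_pair:
  assumes "x \<in> carrier_vec \<alpha>" "x' \<in> carrier_vec \<beta>" "k < \<beta>"
  shows "Z2_Z2u_Psi (x, x') $ (\<alpha> + 2 * k) = fst (z2u_psi (x' $ k))"
    and "Z2_Z2u_Psi (x, x') $ Suc (\<alpha> + 2 * k) = snd (z2u_psi (x' $ k))"
  using assms by (simp_all add: Z2_Z2u_Psi_index[OF assms(1,2)] Suc_diff_le)

lemma Z2_Z2u_Psi_zero: "Z2_Z2u_Psi (0\<^sub>v \<alpha>, 0\<^sub>v \<beta>) = 0\<^sub>v (\<alpha> + 2 * \<beta>)"
  by (rule eq_vecI)
    (auto simp: Z2_Z2u_Psi_index[of _ \<alpha> _ \<beta>] z2u_psi_values Z2_Z2u_Psi_def z2u_psi_vec_def)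

lemma Z2_Z2u_Psi_add:
  assumes "x \<in> carrier_vec \<alpha>" "x' \<in> carrier_vec \<beta>" "y \<in> carrier_vec \<alpha>" "y' \<in> carrier_vec \<beta>"
  shows "Z2_Z2u_Psi (x + y, x' + y') = Z2_Z2u_Psi (x, x') + Z2_Z2u_Psi (y, y')"
proof (rule eq_vecI)
  have carr: "Z2_Z2u_Psi (x, x') \<in> carrier_vec (\<alpha> + 2 * \<beta>)"
    "Z2_Z2u_Psi (y, y') \<in> carrier_vec (\<alpha> + 2 * \<beta>)"
    "Z2_Z2u_Psi (x + y, x' + y') \<in> carrier_vec (\<alpha> + 2 * \<beta>)"
    using assms by (auto intro!: Z2_Z2u_Psi_carrier)
  then show "dim_vec (Z2_Z2u_Psi (x + y, x' + y')) =
    dim_vec (Z2_Z2u_Psi (x, x') + Z2_Z2u_Psi (y, y'))" by simp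
  fix j assume "j < dim_vec (Z2_Z2u_Psi (x, x') + Z2_Z2u_Psi (y, y'))"
  then have "j < \<alpha> + 2 * \<beta>" using carr by simp
  then show "Z2_Z2u_Psi (x + y, x' + y') $ j = (Z2_Z2u_Psi (x, x') + Z2_Z2u_Psi (y, y')) $ j"
    using assms carr
    by (auto simp: Z2_Z2u_Psi_index[of _ \<alpha> _ \<beta>] z2u_psi_def plus_z2u_def algebra_simps)
qed

text \<open>This expresses the module action through binary addition and \<open>S\<close>.
  Multiplication by u sends a + bu to au, with Gray image (a, a), and this is the sum of (b, a + b)
  and its swap (a + b, b). In the first \<alpha> places both sides vanish for the scalar u, since u
  acts there as 0 and \<open>S\<close> as the identity.\<close>

lemma Z2_Z2u_Psi_smult:
  assumes "x \<in> carrier_vec \<alpha>" "x' \<in> carrier_vec \<beta>"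
  shows "Z2_Z2u_Psi (z2u_pi c \<cdot>\<^sub>v x, c \<cdot>\<^sub>v x') = const_coeff c \<cdot>\<^sub>v Z2_Z2u_Psi (x, x')
    + u_coeff c \<cdot>\<^sub>v (Z2_Z2u_Psi (x, x') + swap_vec \<alpha> (Z2_Z2u_Psi (x, x')))"
    (is "?l = ?r")
proof (rule eq_vecI)
  have carr: "Z2_Z2u_Psi (x, x') \<in> carrier_vec (\<alpha> + 2 * \<beta>)"
    "?l \<in> carrier_vec (\<alpha> + 2 * \<beta>)"
    using assms by (auto intro!: Z2_Z2u_Psi_carrier)
  then show "dim_vec ?l = dim_vec ?r" by (simp add: swap_vec_def)
  fix j assume "j < dim_vec ?r"
  then have j: "j < \<alpha> + 2 * \<beta>" using carr by (simp add: swap_vec_def)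
  have r: "?r $ j = const_coeff c * Z2_Z2u_Psi (x, x') $ j
      + u_coeff c * (Z2_Z2u_Psi (x, x') $ j + Z2_Z2u_Psi (x, x') $ pair_swap \<alpha> j)"
    using carr j by (simp add: swap_vec_def)
  from j show "?l $ j = ?r $ j"
  proof (cases rule: pair_index_cases)
    case single
    then show ?thesis unfolding r using assms
      by (simp add: Z2_Z2u_Psi_index[of _ \<alpha> _ \<beta>] z2u_pi_def)
  next
    case (first k)
    show ?thesis unfolding r unfolding first pair_swap_simps
      using assms \<open>k < \<beta>\<close>
      by (cases "const_coeff c"; cases "u_coeff c"; cases "const_coeff (x' $ k)";
          cases "u_coeff (x' $ k)";
          simp add: Z2_Z2u_Psi_index_pair[of _ \<alpha> _ \<beta>] z2u_psi_def times_z2u_def)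
  next
    case (second k)
    show ?thesis unfolding r unfolding second pair_swap_simps
      using assms \<open>k < \<beta>\<close>
      by (cases "const_coeff c"; cases "u_coeff c"; cases "const_coeff (x' $ k)";
          cases "u_coeff (x' $ k)";
          simp add: Z2_Z2u_Psi_index_pair[of _ \<alpha> _ \<beta>] z2u_psi_def times_z2u_def)
  qed
qed

lemma Z2_Z2u_Psi_surj:
  assumes "y \<in> carrier_vec (\<alpha> + 2 * \<beta>)"
  obtains x x' where "x \<in> carrier_vec \<alpha>" "x' \<in> carrier_vec \<beta>" "Z2_Z2u_Psi (x, x') = y"
proof
  define x where "x = vec \<alpha> (\<lambda>i. y $ i)"
  \<comment> \<open>This inverts the Gray map (b, a + b) of a + bu: the first bit of a pair is b,
    and the sum of both bits is a.\<close>
  define x' where "x' = vec \<beta> (\<lambda>k. Z2u (y $ (\<alpha> + 2 * k) + y $ (\<alpha> + 2 * k + 1)) (y $ (\<alpha> + 2 * k)))"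
  show carr: "x \<in> carrier_vec \<alpha>" "x' \<in> carrier_vec \<beta>" by (simp_all add: x_def x'_def)
  show "Z2_Z2u_Psi (x, x') = y"
  proof (rule eq_vecI)
    show "dim_vec (Z2_Z2u_Psi (x, x')) = dim_vec y"
      using Z2_Z2u_Psi_carrier[OF carr] assms by simp
    fix j assume "j < dim_vec y"
    then have j: "j < \<alpha> + 2 * \<beta>" using assms by simp
    then show "Z2_Z2u_Psi (x, x') $ j = y $ j"
    proof (cases rule: pair_index_cases)
      case single
      then show ?thesis using Z2_Z2u_Psi_index[OF carr j] by (simp add: x_def)
    next
      case (first k)
      then show ?thesis
        using Z2_Z2u_Psi_index_pair[OF carr, of k] by (simp add: x'_def z2u_psi_def)
    next
      case (second k)
      then show ?thesis
        using Z2_Z2u_Psi_index_pair[OF carr, of k]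
        by (cases "y $ (\<alpha> + 2 * k)"; cases "y $ (\<alpha> + 2 * k + 1)")
          (simp_all add: x'_def z2u_psi_def)
    qed
  qed
qed

text \<open>The full preimage of \<open>D\<close> under \<open>Z2_Z2u_Psi\<close> serves as the
  code. By \<open>Z2_Z2u_Psi_smult\<close>, closure under scalars reduces to closure under addition
  and \<open>S\<close>; surjectivity of the Gray map makes the image all of
  \<open>D\<close>.\<close>

lemma swap_invariant_is_Psi_image:
  assumes "D \<subseteq> carrier_vec (\<alpha> + 2 * \<beta>)" "0\<^sub>v (\<alpha> + 2 * \<beta>) \<in> D"
    and add: "\<And>x y. x \<in> D \<Longrightarrow> y \<in> D \<Longrightarrow> x + y \<in> D"
    and swap: "\<And>x. x \<in> D \<Longrightarrow> swap_vec \<alpha> x \<in> D"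
  obtains \<C> where "Z2_Z2u_additive \<alpha> \<beta> \<C>" "Z2_Z2u_Psi ` \<C> = D"
proof
  let ?M = "Z2_Z2u_space \<alpha> \<beta>"
  define \<C> where "\<C> = {X \<in> carrier ?M. Z2_Z2u_Psi X \<in> D}"
  interpret M: Module.module class_ring ?M by (rule Z2_Z2u_space_module)
  have bit_smult: "b \<cdot>\<^sub>v y \<in> D" if "y \<in> D" for b y
  proof -
    have "y \<in> carrier_vec (\<alpha> + 2 * \<beta>)" using that assms(1) by blast
    then have "0 \<cdot>\<^sub>v y = 0\<^sub>v (\<alpha> + 2 * \<beta>)" by (intro eq_vecI) auto
    then show ?thesis using assms(2) that by (cases b) auto
  qed
  show "Z2_Z2u_additive \<alpha> \<beta> \<C>"
    unfolding Z2_Z2u_additive_def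
  proof (rule M.submoduleI)
    show "\<C> \<subseteq> carrier ?M" by (auto simp: \<C>_def)
    show "\<zero>\<^bsub>?M\<^esub> \<in> \<C>"
      using assms(2) by (auto simp: \<C>_def Z2_Z2u_space_def Z2_Z2u_Psi_zero)
    show "\<ominus>\<^bsub>?M\<^esub> X \<in> \<C>" if "X \<in> \<C>" for X
    proof -
      \<comment> \<open>In characteristic 2 every element is its own negative.\<close>
      have "X \<oplus>\<^bsub>?M\<^esub> X = \<zero>\<^bsub>?M\<^esub>"
        using that by (auto simp: \<C>_def Z2_Z2u_space_def plus_z2u_def zero_z2u_def intro!: eq_vecI)
      then have "\<ominus>\<^bsub>?M\<^esub> X = X"
        using that by (intro M.minus_equality) (auto simp: \<C>_def)
      then show ?thesis using that by simp
    qed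
    show "X \<oplus>\<^bsub>?M\<^esub> Y \<in> \<C>" if "X \<in> \<C>" "Y \<in> \<C>" for X Y
      using that by (auto simp: \<C>_def Z2_Z2u_space_def Z2_Z2u_Psi_add intro: add)
    show "c \<odot>\<^bsub>?M\<^esub> X \<in> \<C>" if "X \<in> \<C>" for c X
      using that
      by (auto simp: \<C>_def Z2_Z2u_space_def Z2_Z2u_Psi_smult intro!: add bit_smult swap)
  qed
  show "Z2_Z2u_Psi ` \<C> = D"
  proof
    show "D \<subseteq> Z2_Z2u_Psi ` \<C>"
    proof
      fix y assume y: "y \<in> D"
      with assms(1) obtain x x' where "x \<in> carrier_vec \<alpha>" "x' \<in> carrier_vec \<beta>"
        "Z2_Z2u_Psi (x, x') = y" by (meson Z2_Z2u_Psi_surj subsetD)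
      with y show "y \<in> Z2_Z2u_Psi ` \<C>"
        by (intro image_eqI[of _ _ "(x, x')"]) (auto simp: \<C>_def Z2_Z2u_space_def)
    qed
  qed (auto simp: \<C>_def)
qed

section \<open>A linear involution of the syndrome space\<close>

text \<open>The map T = I + N, where N moves entries r places up and fills the first r places with
  zeros.\<close>

definition shear :: "nat \<Rightarrow> bit vec \<Rightarrow> bit vec" where
  "shear r x = vec (dim_vec x) (\<lambda>i. if i < r then x $ i else x $ i + x $ (i - r))"

lemma shear_carrier: "x \<in> carrier_vec t \<Longrightarrow> shear r x \<in> carrier_vec t"
  by (simp add: shear_def)

text \<open>Here T^2 = I + 2N + N^2 = I. In coordinates: for i < t the index i - r lies below r, so
  the entry added at i is one that \<open>shear\<close> leaves unchanged, and adding it twice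
  cancels.\<close>

lemma shear_shear:
  assumes "x \<in> carrier_vec t" "t \<le> 2 * r"
  shows "shear r (shear r x) = x"
  using assms by (intro eq_vecI) (auto simp: shear_def add_ac)

lemma shear_zero: "0 < r \<Longrightarrow> shear r (0\<^sub>v t) = 0\<^sub>v t"
  by (intro eq_vecI) (auto simp: shear_def)

text \<open>A vector is fixed iff N kills it, and N copies precisely the first t - r entries into
  the places from r on.\<close>

lemma shear_fixed_iff:
  assumes "x \<in> carrier_vec t" "r \<le> t"
  shows "shear r x = x \<longleftrightarrow> (\<forall>i < t - r. x $ i = 0)"
proof
  assume eq: "shear r x = x"
  show "\<forall>i < t - r. x $ i = 0"
  proof (intro allI impI)
    fix i assume i: "i < t - r"
    have "shear r x $ (i + r) = x $ (i + r)" by (simp add: eq)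
    then have "x $ (i + r) + x $ i = x $ (i + r)" using i assms by (simp add: shear_def)
    then show "x $ i = 0" by (metis add_cancel_right_right)
  qed
next
  assume "\<forall>i < t - r. x $ i = 0"
  then show "shear r x = x" using assms by (intro eq_vecI) (auto simp: shear_def)
qed

lemma card_shear_fixed:
  assumes "r \<le> t" "0 < r"
  shows "card {x \<in> carrier_vec t - {0\<^sub>v t}. shear r x = x} = 2 ^ r - 1"
proof -
  let ?F = "{x \<in> carrier_vec t. shear r x = x}"
  \<comment> \<open>A fixed vector is determined by its support, which can be any subset of the last
    r places.\<close>
  have "bij_betw (\<lambda>S. vec t (\<lambda>i. of_bool (i \<in> S))) (Pow {t - r..<t}) ?F"
  proof (rule bij_betw_byWitness[where f' = "\<lambda>x. {i. i < t \<and> x $ i = 1}"])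
    show "\<forall>x\<in>?F. vec t (\<lambda>i. of_bool (i \<in> {i. i < t \<and> x $ i = 1})) = x"
      by (auto intro!: eq_vecI)
    show "(\<lambda>S. vec t (\<lambda>i. of_bool (i \<in> S))) ` Pow {t - r..<t} \<subseteq> ?F"
      using assms by (fastforce simp: shear_fixed_iff[of _ t])
    show "(\<lambda>x. {i. i < t \<and> x $ i = 1}) ` ?F \<subseteq> Pow {t - r..<t}"
      using assms by (auto simp: shear_fixed_iff[of _ t]) (metis not_le zero_neq_one)
  qed auto
  then have "card ?F = card (Pow {t - r..<t})" "finite ?F"
    using bij_betw_same_card bij_betw_finite by fastforce+
  then have card: "card ?F = 2 ^ r" and fin: "finite ?F" using assms by (auto simp: card_Pow)
  have "{x \<in> carrier_vec t - {0\<^sub>v t}. shear r x = x} = ?F - {0\<^sub>v t}" by auto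
  moreover have "0\<^sub>v t \<in> ?F" using shear_zero assms(2) by auto
  ultimately show ?thesis using card fin by simp
qed

section \<open>Column permutations of the parity-check matrix\<close>

text \<open>Permuting the entries of \<open>v\<close> by \<sigma> applies T to its syndrome, because
  \<sigma> acts on the columns of \<open>H\<close> as T does. A zero syndrome therefore stays
  zero.\<close>

lemma mat_kernel_reindex:
  assumes H: "H \<in> carrier_mat t n"
    and \<sigma>: "\<And>i. i < n \<Longrightarrow> \<sigma> i < n" "\<And>i. i < n \<Longrightarrow> \<sigma> (\<sigma> i) = i"
    and col: "\<And>i. i < n \<Longrightarrow> col H (\<sigma> i) = shear r (col H i)"
    and v: "v \<in> mat_kernel H"
  shows "vec n (\<lambda>i. v $ \<sigma> i) \<in> mat_kernel H"
proof (rule mat_kernelI[OF H])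
  note vD = mat_kernelD[OF H v]
  have row: "(\<Sum>i = 0..<n. H $$ (k, i) * v $ i) = 0" if "k < t" for k
  proof -
    have "(H *\<^sub>v v) $ k = 0" using vD(2) that by simp
    then show ?thesis using H vD(1) that by (simp add: scalar_prod_def)
  qed
  show "H *\<^sub>v vec n (\<lambda>i. v $ \<sigma> i) = 0\<^sub>v t"
  proof (rule eq_vecI)
    fix k assume "k < dim_vec (0\<^sub>v t :: bit vec)"
    then have k: "k < t" by simp
    have entry: "H $$ (k, \<sigma> i) = (if k < r then H $$ (k, i) else H $$ (k, i) + H $$ (k - r, i))"
      if "i < n" for i
      using arg_cong[OF col[OF that], of "\<lambda>c. c $ k"] H k \<sigma>(1)[OF that] that
      by (simp add: shear_def split: if_splits)
    have "(H *\<^sub>v vec n (\<lambda>i. v $ \<sigma> i)) $ k = (\<Sum>i = 0..<n. H $$ (k, i) * v $ \<sigma> i)"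
      using H k by (simp add: scalar_prod_def)
    \<comment> \<open>Substituting \<open>\<sigma> i\<close> for \<open>i\<close>, with \<sigma> its
      own inverse, moves the permutation from the vector to the columns. Row k of the permuted
      matrix is then row k of \<open>H\<close>, plus row k - r when k is at least r.\<close>
    also have "\<dots> = (\<Sum>i = 0..<n. H $$ (k, \<sigma> i) * v $ i)"
      by (rule sum.reindex_bij_witness[of _ \<sigma> \<sigma>]) (auto simp: \<sigma>)
    also have "\<dots> = (\<Sum>i = 0..<n. H $$ (k, i) * v $ i
        + (if k < r then 0 else H $$ (k - r, i) * v $ i))"
      by (rule sum.cong) (auto simp: entry algebra_simps)
    also have "\<dots> = 0"
      using row[OF k] row[of "k - r"] k by (cases "k < r") (simp_all only: sum.distrib if_True
          if_False sum.neutral_const add_0_right less_imp_diff_less)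
    finally show "(H *\<^sub>v vec n (\<lambda>i. v $ \<sigma> i)) $ k = 0\<^sub>v t $ k" using k by simp
  qed (use H in simp)
qed simp

lemma hamming_kernel_Z2_Z2u_linear:
  assumes Ht: "hamming_parity_check t H" and r: "0 < r" "t \<le> 2 * r" "r \<le> t"
  shows "Z2_Z2u_linear (2 ^ r - 1) (2 ^ (t - 1) - 2 ^ (r - 1)) (mat_kernel H)"
proof -
  define \<alpha> \<beta> n :: nat where "\<alpha> = 2 ^ r - 1" and "\<beta> = 2 ^ (t - 1) - 2 ^ (r - 1)" and "n = 2 ^ t - 1"
  \<comment> \<open>Since 2\<beta> = 2^t - 2^r, this splits the nonzero vectors into those fixed by
    T and those moved. The bounds on r keep the truncated subtractions exact.\<close>
  have n: "n = \<alpha> + 2 * \<beta>"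
  proof -
    have "(2::nat) ^ r = 2 * 2 ^ (r - 1)" "(2::nat) ^ t = 2 * 2 ^ (t - 1)"
      using r by (simp_all flip: power_Suc)
    moreover have "(2::nat) ^ (r - 1) \<le> 2 ^ (t - 1)" "(1::nat) \<le> 2 ^ (r - 1)" using r by simp_all
    ultimately show ?thesis unfolding \<alpha>_def \<beta>_def n_def by linarith
  qed
  let ?V = "carrier_vec t - {0\<^sub>v t :: bit vec}"
  from Ht have H: "H \<in> carrier_mat t n" and dist: "distinct (cols H)" and set: "set (cols H) = ?V"
    by (auto simp: hamming_parity_check_def n_def)
  have cols: "bij_betw (col H) {..<n} ?V"
  proof -
    have "length (cols H) = n" using H by simp
    then have "bij_betw ((!) (cols H)) {..<n} ?V"
      using bij_betw_nth[OF dist] set by simp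
    then show ?thesis
      by (rule bij_betw_cong[THEN iffD1, rotated]) (use H in simp)
  qed
  \<comment> \<open>The columns list every nonzero vector exactly once, so T on nonzero vectors
    transfers to a permutation of the column indices.\<close>
  define \<sigma> where "\<sigma> i = the_inv_into {..<n} (col H) (shear r (col H i))" for i
  \<comment> \<open>A nonzero vector cannot be sent to zero, as applying T again would give back the
    vector itself.\<close>
  have shear_V: "shear r x \<in> ?V" if "x \<in> ?V" for x
    using that r shear_shear[of x t r] shear_zero[of r t] shear_carrier[of x t r] by auto
  have colV: "col H i \<in> ?V" if "i < n" for i using cols that by (auto simp: bij_betw_def)
  have \<sigma>_less: "\<sigma> i < n" and \<sigma>_col: "col H (\<sigma> i) = shear r (col H i)" if "i < n" for i
  proof -
    have "shear r (col H i) \<in> col H ` {..<n}"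
      using shear_V[OF colV[OF that]] cols by (simp add: bij_betw_def)
    then show "\<sigma> i < n" "col H (\<sigma> i) = shear r (col H i)"
      using cols the_inv_into_into[of "col H" "{..<n}" "shear r (col H i)" "{..<n}"]
      by (auto simp: \<sigma>_def bij_betw_def f_the_inv_into_f)
  qed
  have col_eq: "col H i = col H j \<longleftrightarrow> i = j" if "i < n" "j < n" for i j
    using cols that by (auto simp: bij_betw_def inj_on_def)
  have \<sigma>_\<sigma>: "\<sigma> (\<sigma> i) = i" if "i < n" for i
  proof -
    have "col H (\<sigma> (\<sigma> i)) = col H i"
      using that colV[OF that] r by (simp add: \<sigma>_col \<sigma>_less shear_shear[of _ t])
    then show ?thesis using col_eq \<sigma>_less that by blast
  qed
  have "card {i \<in> {..<n}. \<sigma> i = i} = \<alpha>"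
  proof -
    have "bij_betw (col H) {i \<in> {..<n}. \<sigma> i = i} {x \<in> ?V. shear r x = x}"
    proof (rule bij_betw_subset[OF cols])
      have "\<sigma> i = i \<longleftrightarrow> shear r (col H i) = col H i" if "i < n" for i
        using col_eq[OF \<sigma>_less[OF that] that] \<sigma>_col[OF that] by simp
      moreover have "?V = col H ` {..<n}" using cols by (simp add: bij_betw_def)
      ultimately show "col H ` {i \<in> {..<n}. \<sigma> i = i} = {x \<in> ?V. shear r x = x}" by auto
    qed auto
    then show ?thesis using card_shear_fixed r by (simp add: bij_betw_same_card \<alpha>_def)
  qed
  then obtain f where f: "bij_betw f {..<n} {..<n}"
    and f_swap: "\<And>j. j < n \<Longrightarrow> \<sigma> (f j) = f (pair_swap \<alpha> j)"
    using involution_arrangement[of "{..<n}" \<sigma> \<alpha> \<beta>] \<sigma>_less \<sigma>_\<sigma> unfolding n by auto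
  \<comment> \<open>The extension by the identity is what \<open>permutes\<close> demands outside
    the index range.\<close>
  define p where "p j = (if j < n then f j else j)" for j
  have "bij_betw p {..<n} {..<n}"
    using f by (rule bij_betw_cong[THEN iffD1, rotated]) (simp add: p_def)
  then have p: "p permutes {..<n}"
    by (rule bij_imp_permutes) (simp add: p_def)
  have p_less: "p j < n" if "j < n" for j using permutes_in_image[OF p] that by auto
  let ?D = "permute_vec p ` mat_kernel H"
  have ker: "mat_kernel H \<subseteq> carrier_vec n" by (rule mat_kernel_carrier[OF H])
  obtain \<C> where "Z2_Z2u_additive \<alpha> \<beta> \<C>" "Z2_Z2u_Psi ` \<C> = ?D"
  proof (rule swap_invariant_is_Psi_image[of ?D \<alpha> \<beta>, folded n])
    show "?D \<subseteq> carrier_vec n" using ker by (auto simp: permute_vec_def)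
    have "permute_vec p (0\<^sub>v n) = 0\<^sub>v n" by (auto simp: permute_vec_def p_less)
    moreover have "0\<^sub>v n \<in> mat_kernel H" using H by (intro mat_kernelI[OF H]) auto
    ultimately show "0\<^sub>v n \<in> ?D" by (metis imageI)
    show "x + y \<in> ?D" if xy: "x \<in> ?D" "y \<in> ?D" for x y
    proof -
      obtain v w where vw: "v \<in> mat_kernel H" "w \<in> mat_kernel H"
        "x = permute_vec p v" "y = permute_vec p w" using xy by blast
      have carr: "v \<in> carrier_vec n" "w \<in> carrier_vec n" using vw ker by auto
      have "x + y = permute_vec p (v + w)"
        using carr vw by (auto simp: permute_vec_def p_less)
      moreover have "v + w \<in> mat_kernel H"
        using mat_kernelD[OF H vw(1)] mat_kernelD[OF H vw(2)] H
        by (intro mat_kernelI[OF H]) (auto simp: mult_add_distrib_mat_vec[OF H])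
      ultimately show ?thesis by blast
    qed
    show "swap_vec \<alpha> x \<in> ?D" if x: "x \<in> ?D" for x
    proof -
      obtain v where v: "v \<in> mat_kernel H" "x = permute_vec p v" using x by blast
      have carr: "v \<in> carrier_vec n" using v ker by auto
      have less: "pair_swap \<alpha> j < n" if "j < n" for j
        using pair_swap_less that by (simp add: n)
      \<comment> \<open>The arrangement conjugates \<sigma> into \<open>pair_swap\<close>. Hence
        swapping pairs in a permuted codeword amounts to permuting the codeword reindexed by
        \<sigma>, which is again in the kernel.\<close>
      then have "\<sigma> (p j) = p (pair_swap \<alpha> j)" if "j < n" for j
        using f_swap that by (simp add: p_def)
      with less have "swap_vec \<alpha> x = permute_vec p (vec n (\<lambda>i. v $ \<sigma> i))"
        using carr v by (intro eq_vecI) (auto simp: swap_vec_def permute_vec_def p_less)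
      moreover have "vec n (\<lambda>i. v $ \<sigma> i) \<in> mat_kernel H"
        by (rule mat_kernel_reindex[OF H \<sigma>_less \<sigma>_\<sigma> \<sigma>_col v(1)])
      ultimately show ?thesis by blast
    qed
  qed
  then show ?thesis
    unfolding Z2_Z2u_linear_def \<alpha>_def[symmetric] \<beta>_def[symmetric] n[symmetric]
    using ker p by metis
qed

theorem theorem1:
  fixes t r :: nat and H\<^sub>t :: "bit vec set"
  assumes "t \<ge> 3"
    and "binary_hamming_code t H\<^sub>t"
    and "real t / 2 \<le> real r" and "r \<le> t"
  shows "Z2_Z2u_linear (2 ^ r - 1) (2 ^ (t - 1) - 2 ^ (r - 1)) H\<^sub>t"
proof -
  have "0 < r" "t \<le> 2 * r" using assms(1,3) by linarith+
  with assms(2,4) show ?thesis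
    unfolding binary_hamming_code_def using hamming_kernel_Z2_Z2u_linear by blast
qed

end
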